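(* For each $\tilde{\boldsymbol y}\in Y$ and $i\in I(\tilde{\boldsymbol y})$ put $$M_i(\tilde{\boldsymbol y}):=\sum_{j\in J_i:\ r_j(\tilde{\boldsymbol y})=p_{ij}}d_j\,p_{ij}.$$ Then the inequalities $$t\;\ge\;\varphi(\tilde{\boldsymbol y})-\sum_{i\in I(\tilde{\boldsymbol y})}\Biggl(\ \sum_{j\in J_i:\ r_j(\tilde{\boldsymbol y})=p_{ij}}d_j\,p_{ij}\Biggr)x_i,\qquad \tilde{\boldsymbol y}\in Y,$$ form a valid family of interdiction cuts; that is, a vector $\boldsymbol x\in\{0,1\}^m$ satisfies all of these inequalities if and only if $t\ge\xi(\boldsymbol x)$.
   Context: Data: $I=\{1,\dots,m\}$ is a finite set of candidate facility locations and $J=\{1,\dots,n\}$ a finite set of customers. Each $i\in I$ has an opening cost $f_i\ge 0$; each $j\in J$ has a weight $d_j>0$; $p_{ij}\in[0,1]$ is the coverage level provided by location $i$ to customer $j$; $b\ge 0$ is the opening budget and $t\ge 0$ the target coverage. Let $I_j=\{i\in I: 0<p_{ij}\le 1\}$ and $J_i=\{j\in J:0<p_{ij}\le 1\}$. For $\boldsymbol y\in\{0,1\}^m$ let $I(\boldsymbol y)=\{i\in I:y_i=1\}$ and $I_j(\boldsymbol y)=I_j\cap I(\boldsymbol y)$. The (max-min) coverage of customer $j$ is $r_j(\boldsymbol y)=\min_{i\in I_j(\boldsymbol y)}p_{ij}$ if $I_j(\boldsymbol y)\neq\varnothing$, and $r_j(\boldsymbol y)=0$ otherwise. The total coverage is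 $\varphi(\boldsymbol y)=\sum_{j\in J}d_j r_j(\boldsymbol y)$. Let $Y=\{\boldsymbol y\in\{0,1\}^m:\sum_{i\in I}f_iy_i\le b\}$. For a blocker decision $\boldsymbol x\in\{0,1\}^m$ ($x_i=1$ means location $i$ is blocked), the optimal follower value is $\xi(\boldsymbol x)=\max\{\varphi(\boldsymbol y):\boldsymbol y\in Y,\ y_i\le 1-x_i\ \text{for all } i\in I\}$. *)

theory Defs
  imports Complex_Main "HOL-Library.FuncSet"
begin

(* A vector indexed by {1..m} is an extensional function on {1..m}, so that
   distinct functions are distinct vectors and the set of 0/1 vectors is finite. *)
definition binary_vectors :: "nat \<Rightarrow> (nat \<Rightarrow> real) set" where
  "binary_vectors m = {1..m} \<rightarrow>\<^sub>E {0, 1}"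

definition covering_facilities :: "nat \<Rightarrow> (nat \<Rightarrow> nat \<Rightarrow> real) \<Rightarrow> nat \<Rightarrow> nat set" where
  "covering_facilities m p j = {i \<in> {1..m}. 0 < p i j \<and> p i j \<le> 1}"

definition covered_customers :: "nat \<Rightarrow> (nat \<Rightarrow> nat \<Rightarrow> real) \<Rightarrow> nat \<Rightarrow> nat set" where
  "covered_customers n p i = {j \<in> {1..n}. 0 < p i j \<and> p i j \<le> 1}"

definition open_facilities :: "nat \<Rightarrow> (nat \<Rightarrow> real) \<Rightarrow> nat set" where
  "open_facilities m y = {i \<in> {1..m}. y i = 1}"

definition customer_coverage ::
    "nat \<Rightarrow> (nat \<Rightarrow> nat \<Rightarrow> real) \<Rightarrow> (nat \<Rightarrow> real) \<Rightarrow> nat \<Rightarrow> real" where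
  "customer_coverage m p y j =
     (let S = covering_facilities m p j \<inter> open_facilities m y
      in if S = {} then 0 else Min ((\<lambda>i. p i j) ` S))"

definition total_coverage ::
    "nat \<Rightarrow> nat \<Rightarrow> (nat \<Rightarrow> real) \<Rightarrow> (nat \<Rightarrow> nat \<Rightarrow> real) \<Rightarrow> (nat \<Rightarrow> real) \<Rightarrow> real" where
  "total_coverage m n d p y = (\<Sum>j\<in>{1..n}. d j * customer_coverage m p y j)"

definition budget_feasible :: "nat \<Rightarrow> (nat \<Rightarrow> real) \<Rightarrow> real \<Rightarrow> (nat \<Rightarrow> real) set" where
  "budget_feasible m f b = {y \<in> binary_vectors m. (\<Sum>i\<in>{1..m}. f i * y i) \<le> b}"

(* For b \<ge> 0 and x a 0/1 vector, the set under Max is finite and contains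
   the value of the zero vector, so the maximum exists. *)
definition follower_value ::
    "nat \<Rightarrow> nat \<Rightarrow> (nat \<Rightarrow> real) \<Rightarrow> (nat \<Rightarrow> real) \<Rightarrow> (nat \<Rightarrow> nat \<Rightarrow> real) \<Rightarrow> real
      \<Rightarrow> (nat \<Rightarrow> real) \<Rightarrow> real" where
  "follower_value m n f d p b x =
     Max (total_coverage m n d p `
       {y \<in> budget_feasible m f b. \<forall>i\<in>{1..m}. y i \<le> 1 - x i})"

definition cut_coefficient ::
    "nat \<Rightarrow> nat \<Rightarrow> (nat \<Rightarrow> real) \<Rightarrow> (nat \<Rightarrow> nat \<Rightarrow> real) \<Rightarrow> (nat \<Rightarrow> real) \<Rightarrow> nat \<Rightarrow> real" where
  "cut_coefficient m n d p y i =
     (\<Sum>j\<in>{j \<in> covered_customers n p i. customer_coverage m p y j = p i j}. d j * p i j)"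

end

theory Submission imports Defs begin

text \<open>
  A plan that avoids the blocked locations has \<open>x i = 0\<close> at every open facility, so its own cut has
  no correction term and says exactly that its coverage is at most \<open>t\<close>. Hence the cuts imply the
  bound on the follower value.

  Conversely, a feasible plan \<open>y\<close> is compared with its surviving plan, which closes the blocked
  facilities; by nonnegativity of the opening costs it still respects the budget. The cut
  of \<open>y\<close> follows if closing them loses no more coverage than the correction term of the cut
  (\<open>cut_bounds_coverage_loss\<close>). Because coverage is the \<^emph>\<open>minimum\<close> over the open covering
  facilities, closing some of them can only improve a customer's coverage as long as one of them
  remains. A loss occurs only at a customer all of whose open covering facilities are
  blocked (\<open>customer_coverage_loss\<close>); one of these attains the minimum, and the coefficient of this facility
  alone already pays for the entire coverage of that customer.
\<close>

definition surviving_plan :: "nat \<Rightarrow> (nat \<Rightarrow> real) \<Rightarrow> (nat \<Rightarrow> real) \<Rightarrow> nat \<Rightarrow> real" where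
  "surviving_plan m x y = (\<lambda>i\<in>{1..m}. y i * (1 - x i))"

lemma binary_vectors_entry:
  assumes "y \<in> binary_vectors m" "i \<in> {1..m}"
  shows "y i = 0 \<or> y i = 1"
  using assms unfolding binary_vectors_def PiE_def Pi_def by blast

lemma finite_budget_feasible: "finite (budget_feasible m f b)"
  unfolding budget_feasible_def binary_vectors_def by (simp add: finite_PiE)

lemma zero_plan_budget_feasible:
  assumes "0 \<le> b"
  shows "(\<lambda>i\<in>{1..m}. 0) \<in> budget_feasible m f b"
  using assms unfolding budget_feasible_def binary_vectors_def by simp

lemma finite_covering_open:
  "finite (covering_facilities m p j \<inter> open_facilities m y)"
  unfolding covering_facilities_def by simp

lemma customer_coverage_nonneg: "0 \<le> customer_coverage m p y j"
proof -
  have "\<forall>i \<in> covering_facilities m p j \<inter> open_facilities m y. 0 \<le> p i j"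
    unfolding covering_facilities_def by auto
  then show ?thesis
    using finite_covering_open[of m p j y]
    unfolding customer_coverage_def Let_def by simp
qed

lemma customer_coverage_attained:
  assumes "covering_facilities m p j \<inter> open_facilities m y \<noteq> {}"
  obtains i where "i \<in> covering_facilities m p j \<inter> open_facilities m y"
    and "customer_coverage m p y j = p i j"
proof -
  let ?S = "covering_facilities m p j \<inter> open_facilities m y"
  have "Min ((\<lambda>i. p i j) ` ?S) \<in> (\<lambda>i. p i j) ` ?S"
    using assms finite_covering_open by (intro Min_in) auto
  then show thesis
    using that assms unfolding customer_coverage_def Let_def by auto
qed

text \<open>A minimum over fewer facilities is no smaller. This fails once the customer loses its last
  open covering facility, where coverage drops to the default value zero.\<close>

lemma customer_coverage_antimono:
  assumes "open_facilities m z \<subseteq> open_facilities m y"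
    and "covering_facilities m p j \<inter> open_facilities m z \<noteq> {}"
  shows "customer_coverage m p y j \<le> customer_coverage m p z j"
proof -
  have "covering_facilities m p j \<inter> open_facilities m y \<noteq> {}"
    using assms by blast
  moreover have "Min ((\<lambda>i. p i j) ` (covering_facilities m p j \<inter> open_facilities m y))
      \<le> Min ((\<lambda>i. p i j) ` (covering_facilities m p j \<inter> open_facilities m z))"
    using assms finite_covering_open by (intro Min_antimono) auto
  ultimately show ?thesis
    using assms(2) unfolding customer_coverage_def Let_def by simp
qed

text \<open>If an open covering facility survives, antitonicity gives the bound with a nonnegative term to spare.
  Otherwise every open covering facility is blocked, in particular a minimizing one, whose summand equals
  the whole coverage of the customer. Further blocked minimizers only enlarge the sum.\<close>

lemma customer_coverage_loss:
  assumes j: "j \<in> {1..n}"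
    and x: "x \<in> binary_vectors m"
    and z: "open_facilities m z = {i \<in> open_facilities m y. x i = 0}"
  shows "customer_coverage m p y j - customer_coverage m p z j
    \<le> (\<Sum>i | i \<in> open_facilities m y \<and> j \<in> covered_customers n p i
               \<and> customer_coverage m p y j = p i j. p i j * x i)"
    (is "_ \<le> (\<Sum>i\<in>?A. p i j * x i)")
proof -
  have fin: "finite ?A"
    unfolding open_facilities_def by simp
  have term_nonneg: "0 \<le> p i j * x i" if "i \<in> ?A" for i
  proof -
    have "i \<in> {1..m}" "0 < p i j"
      using that unfolding open_facilities_def covered_customers_def by auto
    then show ?thesis
      using binary_vectors_entry[OF x, of i] by force
  qed
  have sum_ge0: "0 \<le> (\<Sum>i\<in>?A. p i j * x i)"
    using term_nonneg by (rule sum_nonneg)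
  show ?thesis
  proof (cases "covering_facilities m p j \<inter> open_facilities m z = {}")
    case False
    then have "customer_coverage m p y j \<le> customer_coverage m p z j"
      using z by (intro customer_coverage_antimono) auto
    then show ?thesis
      using sum_ge0 by linarith
  next
    case lost: True
    show ?thesis
    proof (cases "covering_facilities m p j \<inter> open_facilities m y = {}")
      case True
      then have "customer_coverage m p y j = 0"
        unfolding customer_coverage_def by simp
      then show ?thesis
        using sum_ge0 customer_coverage_nonneg[of m p z j] by linarith
    next
      case False
      then obtain i where i: "i \<in> covering_facilities m p j" "i \<in> open_facilities m y"
        and min: "customer_coverage m p y j = p i j"
        using customer_coverage_attained by blast
      have "x i \<noteq> 0" "i \<in> {1..m}"
        using lost i z unfolding open_facilities_def by auto
      then have "x i = 1"
        using binary_vectors_entry[OF x] by blast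
      have "i \<in> ?A"
        using i min j unfolding covering_facilities_def covered_customers_def by auto
      then have "p i j * x i \<le> (\<Sum>i\<in>?A. p i j * x i)"
        using term_nonneg fin by (intro member_le_sum) auto
      then show ?thesis
        using \<open>x i = 1\<close> min customer_coverage_nonneg[of m p z j] by simp
    qed
  qed
qed

text \<open>Interchanging the two sums regroups the correction term of a cut by customers, so that it can be
  compared with the loss of coverage one customer at a time.\<close>

lemma cut_correction_by_customer:
  "(\<Sum>i\<in>open_facilities m y. cut_coefficient m n d p y i * x i)
    = (\<Sum>j\<in>{1..n}. d j *
        (\<Sum>i | i \<in> open_facilities m y \<and> j \<in> covered_customers n p i
               \<and> customer_coverage m p y j = p i j. p i j * x i))"
proof -
  let ?R = "\<lambda>i j. j \<in> covered_customers n p i \<and> customer_coverage m p y j = p i j"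
  have fin: "finite (open_facilities m y)"
    unfolding open_facilities_def by simp
  have "cut_coefficient m n d p y i * x i
      = (\<Sum>j | j \<in> {1..n} \<and> ?R i j. d j * (p i j * x i))" for i
  proof -
    have "{j \<in> covered_customers n p i. customer_coverage m p y j = p i j}
        = {j. j \<in> {1..n} \<and> ?R i j}"
      unfolding covered_customers_def by auto
    then show ?thesis
      unfolding cut_coefficient_def by (simp add: sum_distrib_right mult.assoc)
  qed
  then have "(\<Sum>i\<in>open_facilities m y. cut_coefficient m n d p y i * x i)
      = (\<Sum>i\<in>open_facilities m y. \<Sum>j | j \<in> {1..n} \<and> ?R i j. d j * (p i j * x i))"
    by simp
  also have "\<dots> = (\<Sum>j\<in>{1..n}. \<Sum>i | i \<in> open_facilities m y \<and> ?R i j. d j * (p i j * x i))"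
    using fin by (intro sum.swap_restrict) auto
  finally show ?thesis
    by (simp add: sum_distrib_left)
qed

lemma cut_bounds_coverage_loss:
  assumes d: "\<And>j. j \<in> {1..n} \<Longrightarrow> 0 \<le> d j"
    and x: "x \<in> binary_vectors m"
    and z: "open_facilities m z = {i \<in> open_facilities m y. x i = 0}"
  shows "total_coverage m n d p y
      - (\<Sum>i\<in>open_facilities m y. cut_coefficient m n d p y i * x i)
    \<le> total_coverage m n d p z"
proof -
  have "total_coverage m n d p y - total_coverage m n d p z
      = (\<Sum>j\<in>{1..n}. d j * (customer_coverage m p y j - customer_coverage m p z j))"
    unfolding total_coverage_def by (simp add: sum_subtractf right_diff_distrib)
  also have "\<dots> \<le> (\<Sum>i\<in>open_facilities m y. cut_coefficient m n d p y i * x i)"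
    unfolding cut_correction_by_customer
    using d x z by (intro sum_mono mult_left_mono customer_coverage_loss) auto
  finally show ?thesis
    by linarith
qed

lemma open_facilities_surviving_plan:
  assumes "x \<in> binary_vectors m" "y \<in> binary_vectors m"
  shows "open_facilities m (surviving_plan m x y) = {i \<in> open_facilities m y. x i = 0}"
proof -
  have "surviving_plan m x y i = 1 \<longleftrightarrow> y i = 1 \<and> x i = 0" if "i \<in> {1..m}" for i
    using that binary_vectors_entry[OF assms(1) that] binary_vectors_entry[OF assms(2) that]
    unfolding surviving_plan_def by force
  then show ?thesis
    unfolding open_facilities_def by blast
qed

lemma surviving_plan_avoids_blocked:
  assumes "x \<in> binary_vectors m" "y \<in> binary_vectors m" "i \<in> {1..m}"
  shows "surviving_plan m x y i \<le> 1 - x i"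
  using assms(3) binary_vectors_entry[OF assms(1,3)] binary_vectors_entry[OF assms(2,3)]
  unfolding surviving_plan_def by force

lemma surviving_plan_budget_feasible:
  assumes f: "\<And>i. i \<in> {1..m} \<Longrightarrow> 0 \<le> f i"
    and x: "x \<in> binary_vectors m"
    and y: "y \<in> budget_feasible m f b"
  shows "surviving_plan m x y \<in> budget_feasible m f b"
proof -
  have yb: "y \<in> binary_vectors m" and cost: "(\<Sum>i\<in>{1..m}. f i * y i) \<le> b"
    using y unfolding budget_feasible_def by auto
  have val: "surviving_plan m x y i \<in> {0, 1} \<and> surviving_plan m x y i \<le> y i"
    if "i \<in> {1..m}" for i
    using that binary_vectors_entry[OF x that] binary_vectors_entry[OF yb that]
    unfolding surviving_plan_def by force
  have "surviving_plan m x y \<in> extensional {1..m}"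
    unfolding surviving_plan_def by simp
  then have "surviving_plan m x y \<in> binary_vectors m"
    using val unfolding binary_vectors_def PiE_def Pi_def by blast
  moreover have "(\<Sum>i\<in>{1..m}. f i * surviving_plan m x y i) \<le> (\<Sum>i\<in>{1..m}. f i * y i)"
    using f val by (intro sum_mono mult_left_mono) auto
  ultimately show ?thesis
    using cost unfolding budget_feasible_def by auto
qed

text \<open>A nonnegative budget makes the zero plan available under every blocker decision, so the maximum
  in the follower value is over a nonempty finite set and can be unfolded into a pointwise bound.\<close>

lemma follower_value_le_iff:
  assumes b: "0 \<le> b" and x: "x \<in> binary_vectors m"
  shows "follower_value m n f d p b x \<le> t
    \<longleftrightarrow> (\<forall>y \<in> budget_feasible m f b.
          (\<forall>i\<in>{1..m}. y i \<le> 1 - x i) \<longrightarrow> total_coverage m n d p y \<le> t)"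
proof -
  let ?F = "{y \<in> budget_feasible m f b. \<forall>i\<in>{1..m}. y i \<le> 1 - x i}"
  have "finite ?F"
    using finite_budget_feasible by simp
  moreover have "(\<lambda>i\<in>{1..m}. 0) \<in> ?F"
    using zero_plan_budget_feasible[OF b, of m f] binary_vectors_entry[OF x] by fastforce
  then have "?F \<noteq> {}"
    by blast
  ultimately show ?thesis
    unfolding follower_value_def by (subst Max_le_iff) auto
qed

theorem proposition2:
  fixes m n :: nat
    and f d :: "nat \<Rightarrow> real"
    and p :: "nat \<Rightarrow> nat \<Rightarrow> real"
    and b t :: real
    and x :: "nat \<Rightarrow> real"
  assumes "\<And>i. i \<in> {1..m} \<Longrightarrow> 0 \<le> f i"
    and "\<And>j. j \<in> {1..n} \<Longrightarrow> 0 < d j"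
    and "\<And>i j. i \<in> {1..m} \<Longrightarrow> j \<in> {1..n} \<Longrightarrow> 0 \<le> p i j \<and> p i j \<le> 1"
    and "0 \<le> b"
    and "0 \<le> t"
    and "x \<in> binary_vectors m"
  shows "(\<forall>y \<in> budget_feasible m f b.
            t \<ge> total_coverage m n d p y
                - (\<Sum>i\<in>open_facilities m y. cut_coefficient m n d p y i * x i))
         \<longleftrightarrow> t \<ge> follower_value m n f d p b x"
  unfolding follower_value_le_iff[OF assms(4,6)]
proof (intro iffI ballI impI)
  fix y
  assume cuts: "\<forall>y \<in> budget_feasible m f b.
      total_coverage m n d p y
        - (\<Sum>i\<in>open_facilities m y. cut_coefficient m n d p y i * x i) \<le> t"
    and y: "y \<in> budget_feasible m f b" and avoids: "\<forall>i\<in>{1..m}. y i \<le> 1 - x i"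
  have "x i = 0" if "i \<in> open_facilities m y" for i
  proof -
    have "i \<in> {1..m}" "y i = 1"
      using that unfolding open_facilities_def by auto
    then show ?thesis
      using avoids binary_vectors_entry[OF assms(6), of i] by force
  qed
  then have "(\<Sum>i\<in>open_facilities m y. cut_coefficient m n d p y i * x i) = 0"
    by simp
  then show "total_coverage m n d p y \<le> t"
    using cuts y by force
next
  fix y
  assume bound: "\<forall>y \<in> budget_feasible m f b.
      (\<forall>i\<in>{1..m}. y i \<le> 1 - x i) \<longrightarrow> total_coverage m n d p y \<le> t"
    and y: "y \<in> budget_feasible m f b"
  let ?z = "surviving_plan m x y"
  have yb: "y \<in> binary_vectors m"
    using y unfolding budget_feasible_def by simp
  have "total_coverage m n d p y
      - (\<Sum>i\<in>open_facilities m y. cut_coefficient m n d p y i * x i)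
    \<le> total_coverage m n d p ?z"
    using assms(2) assms(6) open_facilities_surviving_plan[OF assms(6) yb]
    by (intro cut_bounds_coverage_loss) (auto intro: less_imp_le)
  also have "\<dots> \<le> t"
    using bound surviving_plan_budget_feasible[OF assms(1) assms(6) y]
      surviving_plan_avoids_blocked[OF assms(6) yb] by blast
  finally show "total_coverage m n d p y
      - (\<Sum>i\<in>open_facilities m y. cut_coefficient m n d p y i * x i) \<le> t" .
qed

end
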